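(* For all real numbers $a,b,c$, the algebraic curve $\Gamma=\{(x,y)\in\mathbb{R}^2 : y\,(y-x(1-x))=0\}$ (the union of the $x$-axis and the parabola $y=x(1-x)$) is invariant under the planar polynomial vector field $$\begin{cases}\dot x = ax+by+cxy-ax^2,\\ \dot y=(a+b)y-(2a+2b+c)xy+2cy^2,\end{cases}$$ that is, with $G(x,y)=y(y-x(1-x))$ and $f,g$ denoting the right-hand sides of the first and second equation, $\langle\nabla G(x,y),(f(x,y),g(x,y))\rangle=0$ for all $(x,y)\in\Gamma$. The vector field always has the equilibria $L=(0,0)$ and $M=(1,0)$; the eigenvalues of the linearization at $L$ are $a$ and $a+b$, and those at $M$ are $-a$ and $-a-b-c$. Moreover: (1) For $a=1$, $b=-3$, $c=3/2$, both $L$ and $M$ are hyperbolic saddles, with saddle indices $\lambda=2$ at $L$ and $\mu=2$ at $M$, and the system has a monodromic heteroclinic contour formed by $L$, $M$, the segment $\{(x,0):0<x<1\}$ (an orbit connecting $L$ to $M$) and the parabola arc $\{(x,x(1-x)):0<x<1\}$ (an orbit connecting $M$ to $L$). (2) For $a=1$, $b=-3$, $c=1/2$, both $L$ and $M$ are hyperbolic saddles, with saddle indices $\lambda=2$ at $L$ and $\mu=2/3$ at $M$ (so $\lambda\mu=4/3>1$), and the system has a monodromic heteroclinic contour formed by the same points, segment and arc with the same directions.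
   Context: For a hyperbolic saddle of a planar system with eigenvalues $\lambda_s<0<\lambda_u$, the saddle index is $-\lambda_s/\lambda_u$. A heteroclinic contour consists of two hyperbolic saddles $L$ and $M$ together with an orbit tending to $L$ as $t\to-\infty$ and to $M$ as $t\to+\infty$, and an orbit tending to $M$ as $t\to-\infty$ and to $L$ as $t\to+\infty$. It is called monodromic if, at both saddles, the remaining branches (near the saddle) of the stable and unstable manifolds, i.e. those not contained in the contour, lie outside the closed curve formed by the contour. *)

theory Defs
  imports "HOL-Analysis.Analysis" "HOL-Computational_Algebra.Polynomial"
begin

section \<open>Eigenvalues and hyperbolic saddles\<close>

definition characteristic_poly :: "real ^ 'n ^ 'n \<Rightarrow> real poly" where
  "characteristic_poly A = det (mat [:0, 1:] - map_matrix (\<lambda>r. [:r:]) A)"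

text \<open>Complex eigenvalues, counted with algebraic multiplicity.\<close>

definition eigenvalues :: "real ^ 'n ^ 'n \<Rightarrow> complex multiset" where
  "eigenvalues A = proots (map_poly complex_of_real (characteristic_poly A))"

definition saddle_eigenvalues ::
  "(real ^ 2 \<Rightarrow> real ^ 2) \<Rightarrow> real ^ 2 \<Rightarrow> real \<Rightarrow> real \<Rightarrow> bool" where
  "saddle_eigenvalues F p ls lu \<longleftrightarrow>
     eigenvalues (jacobian F (at p)) = {#complex_of_real ls, complex_of_real lu#} \<and>
     ls < 0 \<and> 0 < lu"

definition hyperbolic_saddle :: "(real ^ 2 \<Rightarrow> real ^ 2) \<Rightarrow> real ^ 2 \<Rightarrow> bool" where
  "hyperbolic_saddle F p \<longleftrightarrow>
     F p = 0 \<and> F differentiable (at p) \<and> (\<exists>ls lu. saddle_eigenvalues F p ls lu)"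

text \<open>Meaningful only at a hyperbolic saddle, where \<open>ls\<close> and \<open>lu\<close> are uniquely determined.\<close>

definition saddle_index :: "(real ^ 2 \<Rightarrow> real ^ 2) \<Rightarrow> real ^ 2 \<Rightarrow> real" where
  "saddle_index F p = (THE r. \<exists>ls lu. saddle_eigenvalues F p ls lu \<and> r = - ls / lu)"

section \<open>Orbits and heteroclinic contours\<close>

definition solution_on ::
  "real set \<Rightarrow> (real ^ 2 \<Rightarrow> real ^ 2) \<Rightarrow> (real \<Rightarrow> real ^ 2) \<Rightarrow> bool" where
  "solution_on T F \<phi> \<longleftrightarrow>
     (\<forall>t\<in>T. (\<phi> has_vector_derivative F (\<phi> t)) (at t within T))"

definition connecting_orbit ::
  "(real ^ 2 \<Rightarrow> real ^ 2) \<Rightarrow> real ^ 2 \<Rightarrow> real ^ 2 \<Rightarrow> (real ^ 2) set \<Rightarrow> bool" where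
  "connecting_orbit F p q \<gamma> \<longleftrightarrow>
     (\<exists>\<phi>. solution_on UNIV F \<phi> \<and> range \<phi> = \<gamma> \<and>
          (\<phi> \<longlongrightarrow> p) at_bot \<and> (\<phi> \<longlongrightarrow> q) at_top)"

definition heteroclinic_contour ::
  "(real ^ 2 \<Rightarrow> real ^ 2) \<Rightarrow> real ^ 2 \<Rightarrow> real ^ 2 \<Rightarrow> (real ^ 2) set \<Rightarrow> (real ^ 2) set \<Rightarrow> bool" where
  "heteroclinic_contour F L M \<gamma>1 \<gamma>2 \<longleftrightarrow>
     L \<noteq> M \<and> hyperbolic_saddle F L \<and> hyperbolic_saddle F M \<and>
     connecting_orbit F L M \<gamma>1 \<and> connecting_orbit F M L \<gamma>2"

definition local_stable_manifold ::
  "(real ^ 2 \<Rightarrow> real ^ 2) \<Rightarrow> real ^ 2 \<Rightarrow> (real ^ 2) set \<Rightarrow> (real ^ 2) set" where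
  "local_stable_manifold F p U =
     {x. \<exists>\<phi>. solution_on {0..} F \<phi> \<and> \<phi> 0 = x \<and> (\<forall>t\<ge>0. \<phi> t \<in> U) \<and> (\<phi> \<longlongrightarrow> p) at_top}"

definition local_unstable_manifold ::
  "(real ^ 2 \<Rightarrow> real ^ 2) \<Rightarrow> real ^ 2 \<Rightarrow> (real ^ 2) set \<Rightarrow> (real ^ 2) set" where
  "local_unstable_manifold F p U =
     {x. \<exists>\<phi>. solution_on {..0} F \<phi> \<and> \<phi> 0 = x \<and> (\<forall>t\<le>0. \<phi> t \<in> U) \<and> (\<phi> \<longlongrightarrow> p) at_bot}"

definition local_branches ::
  "(real ^ 2 \<Rightarrow> real ^ 2) \<Rightarrow> real ^ 2 \<Rightarrow> (real ^ 2) set \<Rightarrow> (real ^ 2) set set" where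
  "local_branches F p U =
     components (local_stable_manifold F p U - {p}) \<union>
     components (local_unstable_manifold F p U - {p})"

definition monodromic_heteroclinic_contour ::
  "(real ^ 2 \<Rightarrow> real ^ 2) \<Rightarrow> real ^ 2 \<Rightarrow> real ^ 2 \<Rightarrow> (real ^ 2) set \<Rightarrow> (real ^ 2) set \<Rightarrow> bool" where
  "monodromic_heteroclinic_contour F L M \<gamma>1 \<gamma>2 \<longleftrightarrow>
     heteroclinic_contour F L M \<gamma>1 \<gamma>2 \<and>
     (let C = {L, M} \<union> \<gamma>1 \<union> \<gamma>2 in
       \<forall>p\<in>{L, M}. \<forall>\<^sub>F r in at_right 0.
         \<forall>B\<in>local_branches F p (ball p r). \<not> B \<subseteq> C \<longrightarrow> B \<subseteq> outside C)"

section \<open>The polynomial family\<close>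

definition vfield :: "real \<Rightarrow> real \<Rightarrow> real \<Rightarrow> real ^ 2 \<Rightarrow> real ^ 2" where
  "vfield a b c p =
     (let x = p $ 1; y = p $ 2 in
      vector [a * x + b * y + c * x * y - a * x\<^sup>2,
              (a + b) * y - (2 * a + 2 * b + c) * x * y + 2 * c * y\<^sup>2])"

definition G :: "real ^ 2 \<Rightarrow> real" where
  "G p = (let x = p $ 1; y = p $ 2 in y * (y - x * (1 - x)))"

definition Gamma_curve :: "(real ^ 2) set" where
  "Gamma_curve = {p. G p = 0}"

definition L :: "real ^ 2" where "L = vector [0, 0]"

definition M :: "real ^ 2" where "M = vector [1, 0]"

definition segment :: "(real ^ 2) set" where
  "segment = {vector [x, 0] | x. 0 < x \<and> x < 1}"

definition parabola_arc :: "(real ^ 2) set" where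
  "parabola_arc = {vector [x, x * (1 - x)] | x. 0 < x \<and> x < 1}"

end

(* Both y and w = y - x(1 - x) are Darboux functions: each derivative along the flow is a multiple
   (the cofactor) of the function itself. At a saddle one cofactor is positive and the other
   negative. A solution converging to the saddle forward (backward) in time must annihilate the
   function whose cofactor is positive (negative) there, so the local stable and unstable manifolds
   lie on the axis and on the parabola. The remaining branches therefore have x < 0 or x > 1, outside
   the convex unit square that contains the contour. *)

theory Submission
  imports Defs
begin

section \<open>Eigenvalues of planar triangular linearizations\<close>

text \<open>Serves both saddles: the axis is invariant, so the lower left Jacobian entry vanishes at
  \<open>L\<close> and \<open>M\<close>. The characteristic polynomial then splits into the linear
  factors of the diagonal entries.\<close>

lemma eigenvalues_upper_triangular:
  fixes A :: "real ^ 2 ^ 2"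
  assumes "A $ 2 $ 1 = 0"
  shows "eigenvalues A = {#complex_of_real (A $ 1 $ 1), complex_of_real (A $ 2 $ 2)#}"
proof -
  have "characteristic_poly A = [:- (A $ 1 $ 1), 1:] * [:- (A $ 2 $ 2), 1:]"
    using assms by (simp add: characteristic_poly_def det_2 mat_def)
  then have "map_poly complex_of_real (characteristic_poly A) =
      [:- complex_of_real (A $ 1 $ 1), 1:] * [:- complex_of_real (A $ 2 $ 2), 1:]"
    by (simp add: map_poly_pCons)
  moreover have "proots ([:- complex_of_real (A $ 1 $ 1), 1:] * [:- complex_of_real (A $ 2 $ 2), 1:])
      = {#complex_of_real (A $ 1 $ 1), complex_of_real (A $ 2 $ 2)#}"
    by (subst proots_mult) auto
  ultimately show ?thesis by (simp add: eigenvalues_def)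
qed

text \<open>Turns \<open>vector [x, y]\<close> into a combination of fixed vectors, so that the
  derivative and limit rules for sums and scalings apply.\<close>

lemma vec2_axis_decomposition: "vector [x, y] = x *\<^sub>R axis 1 1 + y *\<^sub>R (axis 2 1 :: real ^ 2)"
  by (simp add: vec_eq_iff forall_2 axis_def)

lemma has_derivative_vector2:
  assumes "(f has_derivative f') F" and "(g has_derivative g') F"
  shows "((\<lambda>x. vector [f x, g x] :: real ^ 2) has_derivative (\<lambda>h. vector [f' h, g' h])) F"
  unfolding vec2_axis_decomposition using assms by (auto intro!: derivative_eq_intros)

lemma has_vector_derivative_vector2:
  assumes "(f has_real_derivative f') F" and "(g has_real_derivative g') F"
  shows "((\<lambda>x. vector [f x, g x] :: real ^ 2) has_vector_derivative vector [f', g']) F"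
  using has_derivative_vector2[OF assms[unfolded has_field_derivative_def]]
  unfolding has_vector_derivative_def
  by (simp add: vec2_axis_decomposition algebra_simps)

lemma tendsto_vector2:
  assumes "(f \<longlongrightarrow> x) F" and "(g \<longlongrightarrow> y) F"
  shows "((\<lambda>t. vector [f t, g t] :: real ^ 2) \<longlongrightarrow> vector [x, y]) F"
  unfolding vec2_axis_decomposition using assms by (intro tendsto_intros)

lemma has_derivative_nth [derivative_intros]:
  "((\<lambda>p. p $ i) has_derivative (\<lambda>h. h $ i)) F"
  by (rule bounded_linear_imp_has_derivative) (rule bounded_linear_vec_nth)

section \<open>Linearization of the family at the equilibria\<close>

lemma has_derivative_vfield:
  "(vfield a b c has_derivative (\<lambda>h. vector
     [(a + c * p $ 2 - 2 * a * p $ 1) * h $ 1 + (b + c * p $ 1) * h $ 2,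
      - (2 * a + 2 * b + c) * p $ 2 * h $ 1 +
      (a + b - (2 * a + 2 * b + c) * p $ 1 + 4 * c * p $ 2) * h $ 2])) (at p)"
  unfolding vfield_def Let_def
  by (rule has_derivative_eq_rhs, rule has_derivative_vector2)
     (auto intro!: derivative_eq_intros simp: vec_eq_iff forall_2 algebra_simps power2_eq_square)

lemma jacobian_vfield:
  "jacobian (vfield a b c) (at p) = vector
     [vector [a + c * p $ 2 - 2 * a * p $ 1, b + c * p $ 1],
      vector [- (2 * a + 2 * b + c) * p $ 2,
              a + b - (2 * a + 2 * b + c) * p $ 1 + 4 * c * p $ 2]]"
  unfolding jacobian_def frechet_derivative_at[OF has_derivative_vfield, symmetric]
  by (simp add: matrix_def vec_eq_iff forall_2 axis_def)

lemma eigenvalues_vfield_L: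
  "eigenvalues (jacobian (vfield a b c) (at L)) = {#complex_of_real a, complex_of_real (a + b)#}"
  by (subst eigenvalues_upper_triangular) (simp_all add: jacobian_vfield L_def)

lemma eigenvalues_vfield_M:
  "eigenvalues (jacobian (vfield a b c) (at M)) =
     {#complex_of_real (- a), complex_of_real (- a - b - c)#}"
  by (subst eigenvalues_upper_triangular) (simp_all add: jacobian_vfield M_def)

lemma vfield_L [simp]: "vfield a b c L = 0"
  by (simp add: vfield_def L_def vec_eq_iff forall_2)

lemma vfield_M [simp]: "vfield a b c M = 0"
  by (simp add: vfield_def M_def vec_eq_iff forall_2)

text \<open>The eigenvalue multiset fixes the pair only up to order; the sign conditions fix the
  order, so the description in \<open>saddle_index\<close> is unique.\<close>

lemma saddle_index_eq:
  assumes "saddle_eigenvalues F p ls lu"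
  shows "saddle_index F p = - ls / lu"
  unfolding saddle_index_def
proof (rule the_equality)
  show "\<exists>ls' lu'. saddle_eigenvalues F p ls' lu' \<and> - ls / lu = - ls' / lu'"
    using assms by blast
  fix r assume "\<exists>ls lu. saddle_eigenvalues F p ls lu \<and> r = - ls / lu"
  then obtain ls' lu' where r: "saddle_eigenvalues F p ls' lu'" "r = - ls' / lu'" by blast
  then have "{#complex_of_real ls', complex_of_real lu'#} = {#complex_of_real ls, complex_of_real lu#}"
    using assms by (simp add: saddle_eigenvalues_def)
  then have "ls' = ls \<and> lu' = lu \<or> ls' = lu \<and> lu' = ls"
    by (auto simp: add_eq_conv_ex)
  then show "r = - ls / lu"
    using r assms by (auto simp: saddle_eigenvalues_def)
qed

text \<open>The eigenvalue \<open>a\<close> belongs to the axis direction (1, 0), and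
  \<open>a + b\<close> to (1, 1), tangent to the parabola. So \<open>L\<close> expands along the
  axis and contracts along the parabola.\<close>

lemma saddle_eigenvalues_L:
  assumes "a > 0" and "a + b < 0"
  shows "saddle_eigenvalues (vfield a b c) L (a + b) a"
  using assms by (simp add: saddle_eigenvalues_def eigenvalues_vfield_L add_mset_commute)

text \<open>The roles are swapped: \<open>M\<close> contracts along the axis and expands along (1,
  -1), the tangent of the parabola there.\<close>

lemma saddle_eigenvalues_M:
  assumes "a > 0" and "a + b + c < 0"
  shows "saddle_eigenvalues (vfield a b c) M (- a) (- a - b - c)"
  using assms by (simp add: saddle_eigenvalues_def eigenvalues_vfield_M)

lemma differentiable_vfield: "vfield a b c differentiable (at p)"
  using has_derivative_vfield differentiable_def by blast

lemma hyperbolic_saddle_L: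
  assumes "a > 0" and "a + b < 0"
  shows "hyperbolic_saddle (vfield a b c) L"
  using saddle_eigenvalues_L[OF assms] differentiable_vfield by (auto simp: hyperbolic_saddle_def)

lemma hyperbolic_saddle_M:
  assumes "a > 0" and "a + b + c < 0"
  shows "hyperbolic_saddle (vfield a b c) M"
  using saddle_eigenvalues_M[OF assms] differentiable_vfield by (auto simp: hyperbolic_saddle_def)

section \<open>The invariant curve\<close>

lemma Gamma_curve_eq:
  "Gamma_curve = {p. p $ 2 = 0} \<union> {p. p $ 2 = p $ 1 * (1 - p $ 1)}"
  by (auto simp: Gamma_curve_def G_def Let_def)

text \<open>\<open>G\<close> is the product of y and y - x(1 - x), both with polynomial cofactors,
  so its derivative along the field is a multiple of \<open>G\<close>. The proof checks the two
  components of the curve separately.\<close>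

lemma Gamma_curve_invariant:
  assumes "p \<in> Gamma_curve"
  shows "\<exists>D. GDERIV G p :> D \<and> D \<bullet> vfield a b c p = 0"
proof (intro exI conjI)
  let ?D = "vector [- (p $ 2 * (1 - 2 * p $ 1)), 2 * p $ 2 - p $ 1 * (1 - p $ 1)] :: real ^ 2"
  show "GDERIV G p :> ?D"
    unfolding gderiv_def G_def Let_def
    by (auto intro!: derivative_eq_intros simp: inner_vec_def sum_2 algebra_simps fun_eq_iff)
  show "?D \<bullet> vfield a b c p = 0"
    using assms unfolding Gamma_curve_eq
  proof
    assume "p \<in> {p. p $ 2 = 0}"
    then show ?thesis by (simp add: inner_vec_def sum_2 vfield_def Let_def algebra_simps power2_eq_square)
  next
    assume "p \<in> {p. p $ 2 = p $ 1 * (1 - p $ 1)}"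
    then have "p $ 2 = p $ 1 * (1 - p $ 1)" by simp
    then show ?thesis
      unfolding inner_vec_def sum_2 vfield_def Let_def vector_2 inner_real_def by algebra
  qed
qed

section \<open>Cofactors and the location of the local invariant manifolds\<close>

text \<open>Darboux functions: \<open>h\<close> vanishes on an invariant curve, and \<open>k\<close> is its cofactor.\<close>

definition darboux :: "(real ^ 2 \<Rightarrow> real ^ 2) \<Rightarrow> (real ^ 2 \<Rightarrow> real) \<Rightarrow> (real ^ 2 \<Rightarrow> real) \<Rightarrow> bool" where
  "darboux F h k \<longleftrightarrow> (\<forall>q. \<exists>h'. (h has_derivative h') (at q) \<and> h' (F q) = h q * k q)"

text \<open>The second component of the field is divisible by y, and the cofactor is the quotient.
  At an equilibrium it equals the eigenvalue transverse to the axis: \<open>a + b\<close> at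
  \<open>L\<close>, \<open>- a - b - c\<close> at \<open>M\<close>.\<close>

lemma darboux_axis:
  "darboux (vfield a b c) (\<lambda>q. q $ 2)
     (\<lambda>q. a + b - (2 * a + 2 * b + c) * q $ 1 + 2 * c * q $ 2)"
  unfolding darboux_def
proof (intro allI exI conjI)
  fix q :: "real ^ 2"
  show "((\<lambda>q. q $ 2) has_derivative (\<lambda>h. h $ 2)) (at q)"
    by (rule has_derivative_nth)
qed (simp add: vfield_def Let_def algebra_simps power2_eq_square)

text \<open>The cofactor equals \<open>a\<close> at \<open>L\<close> and \<open>- a\<close> at
  \<open>M\<close>, the eigenvalues of the axis direction, which is transverse to the
  parabola.\<close>

lemma darboux_parabola:
  "darboux (vfield a b c) (\<lambda>q. q $ 2 - q $ 1 * (1 - q $ 1))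
     (\<lambda>q. a * (1 - 2 * q $ 1) + 2 * c * q $ 2)"
  unfolding darboux_def
proof (intro allI exI conjI)
  fix q :: "real ^ 2"
  show "((\<lambda>q. q $ 2 - q $ 1 * (1 - q $ 1)) has_derivative
      (\<lambda>h. h $ 2 - (1 - 2 * q $ 1) * h $ 1)) (at q)"
    by (auto intro!: derivative_eq_intros simp: algebra_simps)
qed (simp add: vfield_def Let_def algebra_simps power2_eq_square)

text \<open>Chain rule. Derivatives are taken within \<open>T\<close> so that half-lines, with a
  one-sided derivative at time 0, are covered.\<close>

lemma darboux_along_solution:
  assumes "darboux F h k" and "solution_on T F \<phi>" and "t \<in> T"
  shows "((\<lambda>t. h (\<phi> t)) has_real_derivative h (\<phi> t) * k (\<phi> t)) (at t within T)"
proof -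
  obtain h' where h': "(h has_derivative h') (at (\<phi> t))" "h' (F (\<phi> t)) = h (\<phi> t) * k (\<phi> t)"
    using assms(1) unfolding darboux_def by blast
  have "(\<phi> has_derivative (\<lambda>s. s *\<^sub>R F (\<phi> t))) (at t within T)"
    using assms(2,3) by (auto simp: solution_on_def has_vector_derivative_def)
  then have "((\<lambda>t. h (\<phi> t)) has_derivative (\<lambda>s. h' (s *\<^sub>R F (\<phi> t)))) (at t within T)"
    using h'(1) by (rule has_derivative_compose)
  then show ?thesis
    using h' by (simp add: has_field_derivative_def mult_commute_abs
        linear_scale[OF has_derivative_linear[OF h'(1)]] mult.commute)
qed

lemma darboux_isCont:
  assumes "darboux F h k"
  shows "isCont h q"
  using assms has_derivative_continuous unfolding darboux_def by blast

text \<open>Since \<open>(h\<^sup>2)' = 2 k h\<^sup>2\<close> along solutions, a nonnegative cofactor forbids \<open>h\<close> to decay.\<close>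

lemma local_stable_manifold_subset_darboux:
  assumes D: "darboux F h k" and "h p = 0" and k: "\<And>q. q \<in> U \<Longrightarrow> 0 \<le> k q"
  shows "local_stable_manifold F p U \<subseteq> {q. h q = 0}"
proof
  fix x assume "x \<in> local_stable_manifold F p U"
  then obtain \<phi> where sol: "solution_on {0..} F \<phi>" and x: "\<phi> 0 = x"
      and U: "\<And>t. t \<ge> 0 \<Longrightarrow> \<phi> t \<in> U" and lim: "(\<phi> \<longlongrightarrow> p) at_top"
    unfolding local_stable_manifold_def by blast
  let ?u = "\<lambda>t. (h (\<phi> t))\<^sup>2"
  have der: "(?u has_real_derivative 2 * k (\<phi> t) * ?u t) (at t within {0..})" if "t \<ge> 0" for t
    using darboux_along_solution[OF D sol] that
    by (auto intro!: derivative_eq_intros simp: power2_eq_square)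
  \<comment> \<open>Only interior times, where the derivative within the half-line is two-sided, and
    continuity up to the endpoints are needed.\<close>
  have mono: "?u 0 \<le> ?u s" if "s \<ge> 0" for s
  proof (rule DERIV_nonneg_imp_increasing_open[OF that])
    fix t assume t: "0 < t" "t < s"
    then have "(?u has_real_derivative 2 * k (\<phi> t) * ?u t) (at t)"
      using der[of t] by (simp add: at_within_interior[of t "{0..}"])
    moreover have "0 \<le> 2 * k (\<phi> t) * ?u t"
      using k U t by simp
    ultimately show "\<exists>y. (?u has_real_derivative y) (at t) \<and> 0 \<le> y" by blast
  next
    show "continuous_on {0..s} ?u"
      by (rule continuous_on_subset[of "{0..}"], rule DERIV_continuous_on[OF der]) auto
  qed
  have "((\<lambda>t. h (\<phi> t)) \<longlongrightarrow> 0) at_top"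
    using isCont_tendsto_compose[OF darboux_isCont[OF D] lim] \<open>h p = 0\<close> by simp
  then have "(?u \<longlongrightarrow> 0\<^sup>2) at_top" by (intro tendsto_intros)
  \<comment> \<open>\<open>?u\<close> never drops below \<open>?u 0\<close> and yet tends to
    0.\<close>
  then have "?u 0 \<le> 0\<^sup>2"
    using mono by (intro tendsto_lowerbound[where f = ?u]) (auto intro: eventually_at_top_linorderI)
  then show "x \<in> {q. h q = 0}" using x by simp
qed

text \<open>Mirror image in time: with a nonpositive cofactor the square of \<open>h\<close> does
  not increase along the flow, so its value at 0 is bounded by its limit 0 in the distant
  past.\<close>

lemma local_unstable_manifold_subset_darboux:
  assumes D: "darboux F h k" and "h p = 0" and k: "\<And>q. q \<in> U \<Longrightarrow> k q \<le> 0"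
  shows "local_unstable_manifold F p U \<subseteq> {q. h q = 0}"
proof
  fix x assume "x \<in> local_unstable_manifold F p U"
  then obtain \<phi> where sol: "solution_on {..0} F \<phi>" and x: "\<phi> 0 = x"
      and U: "\<And>t. t \<le> 0 \<Longrightarrow> \<phi> t \<in> U" and lim: "(\<phi> \<longlongrightarrow> p) at_bot"
    unfolding local_unstable_manifold_def by blast
  let ?u = "\<lambda>t. (h (\<phi> t))\<^sup>2"
  have der: "(?u has_real_derivative 2 * k (\<phi> t) * ?u t) (at t within {..0})" if "t \<le> 0" for t
    using darboux_along_solution[OF D sol] that
    by (auto intro!: derivative_eq_intros simp: power2_eq_square)
  have mono: "?u 0 \<le> ?u s" if "s \<le> 0" for s
  proof (rule DERIV_nonpos_imp_decreasing_open[OF that])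
    fix t assume t: "s < t" "t < 0"
    then have "(?u has_real_derivative 2 * k (\<phi> t) * ?u t) (at t)"
      using der[of t] by (simp add: at_within_interior[of t "{..0}"])
    moreover have "2 * k (\<phi> t) * ?u t \<le> 0"
      using k U t by (simp add: mult_nonpos_nonneg)
    ultimately show "\<exists>y. (?u has_real_derivative y) (at t) \<and> y \<le> 0" by blast
  next
    show "continuous_on {s..0} ?u"
      by (rule continuous_on_subset[of "{..0}"], rule DERIV_continuous_on[OF der]) auto
  qed
  have "((\<lambda>t. h (\<phi> t)) \<longlongrightarrow> 0) at_bot"
    using isCont_tendsto_compose[OF darboux_isCont[OF D] lim] \<open>h p = 0\<close> by simp
  then have "(?u \<longlongrightarrow> 0\<^sup>2) at_bot" by (intro tendsto_intros)
  then have "?u 0 \<le> 0\<^sup>2"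
    using mono by (intro tendsto_lowerbound[where f = ?u]) (auto intro: eventually_at_bot_linorderI)
  then show "x \<in> {q. h q = 0}" using x by simp
qed

section \<open>The connecting orbits\<close>

text \<open>Partial fractions integrate \<open>dx / (x (1 - x) (\<alpha> + c x))\<close>; the solution is the inverse of
  this time function.\<close>

lemma cubic_flow_exists:
  fixes \<alpha> c :: real
  assumes \<alpha>: "\<alpha> < 0" and \<beta>: "\<alpha> + c < 0"
  obtains \<xi> :: "real \<Rightarrow> real" where
    "\<And>t. (\<xi> has_real_derivative \<xi> t * (1 - \<xi> t) * (\<alpha> + c * \<xi> t)) (at t)"
    "range \<xi> = {0<..<1}" "(\<xi> \<longlongrightarrow> 1) at_bot" "(\<xi> \<longlongrightarrow> 0) at_top"
proof -
  define \<beta> where "\<beta> = \<alpha> + c"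
  \<comment> \<open>The coefficients are those of the partial fractions; \<open>\<beta>\<close> is
    the value of the linear factor at 1. The factor is negative on [0, 1], hence the sign inside the
    last logarithm. For \<open>c = 0\<close> that term vanishes, which covers the motion on the
    axis.\<close>
  define T where "T x = ln x / \<alpha> - ln (1 - x) / \<beta> - c / (\<alpha> * \<beta>) * ln (- \<alpha> - c * x)" for x
  have \<beta>0: "\<beta> < 0" using \<beta> by (simp add: \<beta>_def)
  have neg: "\<alpha> + c * x < 0" if "0 \<le> x" "x \<le> 1" for x
  proof -
    have "\<alpha> + c * x = (1 - x) * \<alpha> + x * \<beta>" by (simp add: \<beta>_def algebra_simps)
    moreover have "(1 - x) * \<alpha> + x * \<beta> < 0"
    proof (cases "x = 1")
      case False
      then have "(1 - x) * \<alpha> < 0" "x * \<beta> \<le> 0"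
        using that \<alpha> \<beta>0 by (auto simp: mult_pos_neg mult_nonneg_nonpos)
      then show ?thesis by simp
    qed (use \<beta>0 in simp)
    ultimately show ?thesis by simp
  qed
  have vel: "x * (1 - x) * (\<alpha> + c * x) < 0" if "0 < x" "x < 1" for x
    using neg[of x] that by (intro mult_pos_neg) auto
  have der: "(T has_real_derivative inverse (x * (1 - x) * (\<alpha> + c * x))) (at x)"
    if "0 < x" "x < 1" for x
  proof -
    have "(T has_real_derivative
        1 / x / \<alpha> + 1 / (1 - x) / \<beta> + c / (\<alpha> * \<beta>) * (c / (- \<alpha> - c * x))) (at x)"
      unfolding T_def using that neg[of x] \<alpha> \<beta>0
      by (auto intro!: derivative_eq_intros)
    moreover have "1 / x / \<alpha> + 1 / (1 - x) / \<beta> + c / (\<alpha> * \<beta>) * (c / (- \<alpha> - c * x)) =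
        inverse (x * (1 - x) * (\<alpha> + c * x))"
    proof -
      have nz: "x \<noteq> 0" "1 - x \<noteq> 0" "\<alpha> \<noteq> 0" "\<beta> \<noteq> 0" "\<alpha> + c * x \<noteq> 0" "- \<alpha> - c * x \<noteq> 0"
        using that neg[of x] \<alpha> \<beta>0 by auto
      have "c / (- \<alpha> - c * x) = - (c / (\<alpha> + c * x))"
        using nz by (simp add: field_simps)
      then show ?thesis
        using nz by (simp add: divide_simps) (simp add: \<beta>_def algebra_simps power2_eq_square)
    qed
    ultimately show ?thesis by simp
  qed
  \<comment> \<open>The velocity is negative, so the time function strictly decreases.\<close>
  have less_iff: "T y < T x \<longleftrightarrow> x < y" if "0 < x" "x < 1" "0 < y" "y < 1" for x y
  proof -
    have *: "T v < T u" if "0 < u" "u < v" "v < 1" for u v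
    proof (rule DERIV_neg_imp_decreasing[OF that(2)])
      fix z assume "u \<le> z" "z \<le> v"
      then show "\<exists>y. (T has_real_derivative y) (at z) \<and> y < 0"
        using der[of z] vel[of z] that inverse_negative_iff_negative
        by (metis less_le_trans le_less_trans)
    qed
    show ?thesis using *[of x y] *[of y x] that by (metis less_asym less_linear)
  qed
  \<comment> \<open>Only the term \<open>ln x / \<alpha>\<close> is unbounded at 0, and
    \<open>\<alpha>\<close> is negative; the other two terms converge.\<close>
  have lim0: "filterlim T at_top (at_right 0)"
  proof -
    have "filterlim (\<lambda>x. - (1 / \<alpha>) * - ln x) at_top (at_right 0)"
      using \<alpha> ln_at_0
      by (intro filterlim_tendsto_pos_mult_at_top[OF tendsto_const])
         (auto simp: filterlim_uminus_at_bot)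
    moreover have "((\<lambda>x. - ln (1 - x) / \<beta> - c / (\<alpha> * \<beta>) * ln (- \<alpha> - c * x)) \<longlongrightarrow>
        - ln (1 - 0) / \<beta> - c / (\<alpha> * \<beta>) * ln (- \<alpha> - c * 0)) (at_right 0)"
      using \<alpha> \<beta>0 by (intro tendsto_intros) auto
    ultimately have "filterlim (\<lambda>x. (- ln (1 - x) / \<beta> - c / (\<alpha> * \<beta>) * ln (- \<alpha> - c * x)) +
        - (1 / \<alpha>) * - ln x) at_top (at_right 0)"
      by (intro filterlim_tendsto_add_at_top)
    then show ?thesis unfolding T_def by (simp add: algebra_simps)
  qed
  \<comment> \<open>At 1 only \<open>ln (1 - x) / \<beta>\<close> is unbounded. The claim is for
    \<open>- T\<close> so that the same rule for limits \<open>at_top\<close> applies.\<close>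
  have lim1: "filterlim (\<lambda>x. - T x) at_top (at_left 1)"
  proof -
    have "filterlim (\<lambda>x :: real. 1 - x) (at_right 0) (at_left 1)"
      unfolding filterlim_at
      by (auto intro!: tendsto_eq_intros simp: eventually_at_filter)
    from filterlim_compose[OF ln_at_0 this]
    have "filterlim (\<lambda>x. - (1 / \<beta>) * - ln (1 - x)) at_top (at_left 1)"
      using \<beta>0
      by (intro filterlim_tendsto_pos_mult_at_top[OF tendsto_const])
         (auto simp: filterlim_uminus_at_bot)
    moreover have "((\<lambda>x. - ln x / \<alpha> + c / (\<alpha> * \<beta>) * ln (- \<alpha> - c * x)) \<longlongrightarrow>
        - ln 1 / \<alpha> + c / (\<alpha> * \<beta>) * ln (- \<alpha> - c * 1)) (at_left 1)"
      using \<alpha> \<beta> by (intro tendsto_intros) auto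
    ultimately have "filterlim (\<lambda>x. (- ln x / \<alpha> + c / (\<alpha> * \<beta>) * ln (- \<alpha> - c * x)) +
        - (1 / \<beta>) * - ln (1 - x)) at_top (at_left 1)"
      by (intro filterlim_tendsto_add_at_top)
    then show ?thesis unfolding T_def by (simp add: algebra_simps)
  qed
  have surj: "\<exists>x. 0 < x \<and> x < 1 \<and> T x = t" for t
  proof -
    \<comment> \<open>The bound 1/2 separates \<open>u\<close> from \<open>v\<close>, so the
      intermediate value theorem applies on an interval inside (0, 1).\<close>
    have "eventually (\<lambda>x. t \<le> T x \<and> x \<in> {0<..<1/2}) (at_right 0)"
      using lim0 eventually_at_right_real[of 0 "1/2"] unfolding filterlim_at_top
      by (intro eventually_conj) auto
    then obtain u where u: "t \<le> T u" "0 < u" "u < 1/2"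
      using eventually_happens trivial_limit_at_right_real by fastforce
    have "eventually (\<lambda>x. - t \<le> - T x \<and> x \<in> {1/2<..<1}) (at_left 1)"
      using lim1 eventually_at_left_real[of "1/2" 1] unfolding filterlim_at_top
      by (intro eventually_conj) (blast, simp)
    then obtain v where v: "T v \<le> t" "1/2 < v" "v < 1"
      using eventually_happens trivial_limit_at_left_real by fastforce
    have "\<forall>x. u \<le> x \<and> x \<le> v \<longrightarrow> isCont T x"
      using u v by (auto intro!: DERIV_isCont der)
    then obtain x where "u \<le> x" "x \<le> v" "T x = t"
      using IVT2[of T v t u] u v by auto
    then show ?thesis using u v by (intro exI[of _ x]) auto
  qed
  define \<xi> where "\<xi> t = (SOME x. 0 < x \<and> x < 1 \<and> T x = t)" for t
  have \<xi>: "0 < \<xi> t" "\<xi> t < 1" "T (\<xi> t) = t" for t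
    using someI_ex[OF surj[of t]] by (auto simp: \<xi>_def)
  have \<xi>T: "\<xi> (T x) = x" if "0 < x" "x < 1" for x
    using less_iff[of x "\<xi> (T x)"] less_iff[of "\<xi> (T x)" x] \<xi>[of "T x"] that
    by (metis less_irrefl less_linear)
  have cont: "isCont \<xi> t" for t
  proof -
    have "isCont \<xi> (T (\<xi> t))"
    \<comment> \<open>The endpoints are the midpoints between \<open>\<xi> t\<close> and 0, and
      between \<open>\<xi> t\<close> and 1, so this interval stays inside (0, 1) with
      \<open>\<xi> t\<close> in its interior.\<close>
    proof (rule isCont_inverse_function2[of "\<xi> t / 2" _ "(1 + \<xi> t) / 2" \<xi> T])
      fix z assume "\<xi> t / 2 \<le> z" "z \<le> (1 + \<xi> t) / 2"
      then have "0 < z" "z < 1" using \<xi>[of t] by auto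
      then show "\<xi> (T z) = z" "isCont T z" using \<xi>T der DERIV_isCont by blast+
    qed (use \<xi>[of t] in auto)
    then show ?thesis by (simp add: \<xi>)
  qed
  show ?thesis
  proof
    fix t
    \<comment> \<open>The derivative of an inverse function is the reciprocal of \<open>T'\<close>,
      and \<open>T'\<close> is itself the reciprocal of the velocity.\<close>
    have "(\<xi> has_real_derivative inverse (inverse (\<xi> t * (1 - \<xi> t) * (\<alpha> + c * \<xi> t)))) (at t)"
      by (rule DERIV_inverse_function[of T _ _ _ "t - 1" "t + 1"])
         (use der \<xi> vel[of "\<xi> t"] cont in auto)
    then show "(\<xi> has_real_derivative \<xi> t * (1 - \<xi> t) * (\<alpha> + c * \<xi> t)) (at t)" by simp
  next
    show "range \<xi> = {0<..<1}"
    proof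
      show "range \<xi> \<subseteq> {0<..<1}" using \<xi> by auto
      show "{0<..<1} \<subseteq> range \<xi>"
      proof
        fix x :: real assume "x \<in> {0<..<1}"
        then have "x = \<xi> (T x)" using \<xi>T by simp
        then show "x \<in> range \<xi>" by (rule range_eqI)
      qed
    qed
  next
    show "(\<xi> \<longlongrightarrow> 1) at_bot"
    proof (rule order_tendstoI)
      fix l :: real assume "l < 1"
      \<comment> \<open>Moves the bound into (0, 1), where \<open>less_iff\<close> compares times
        with positions.\<close>
      define m where "m = max l (1/2)"
      have m: "0 < m" "m < 1" "l \<le> m" using \<open>l < 1\<close> by (auto simp: m_def)
      have "l < \<xi> t" if "t < T m" for t
        using less_iff[of m "\<xi> t"] that m \<xi>[of t] by auto
      then show "eventually (\<lambda>t. l < \<xi> t) at_bot"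
        using eventually_at_bot_dense by blast
    next
      fix l :: real assume "1 < l"
      then show "eventually (\<lambda>t. \<xi> t < l) at_bot"
        using \<xi>(2) less_trans by (auto intro!: always_eventually)
    qed
    show "(\<xi> \<longlongrightarrow> 0) at_top"
    proof (rule order_tendstoI)
      fix l :: real assume "0 < l"
      define m where "m = min l (1/2)"
      have m: "0 < m" "m < 1" "m \<le> l" using \<open>0 < l\<close> by (auto simp: m_def)
      have "\<xi> t < l" if "T m < t" for t
        using less_iff[of "\<xi> t" m] that m \<xi>[of t] by auto
      then show "eventually (\<lambda>t. \<xi> t < l) at_top"
        using eventually_at_top_dense by blast
    next
      fix l :: real assume "l < 0"
      then show "eventually (\<lambda>t. l < \<xi> t) at_top"
        using \<xi>(1) less_trans by (auto intro!: always_eventually)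
    qed
  qed
qed

text \<open>On the axis the field is the logistic equation x' = a x (1 - x), which moves from 0 to
  1. The cubic flow runs from 1 to 0, so it is taken with \<open>\<alpha> = - a\<close>,
  \<open>c = 0\<close> and time reversed.\<close>

lemma connecting_orbit_segment:
  assumes "a > 0"
  shows "connecting_orbit (vfield a b c) L M segment"
proof -
  obtain \<xi> where \<xi>: "\<And>t. (\<xi> has_real_derivative \<xi> t * (1 - \<xi> t) * (- a + 0 * \<xi> t)) (at t)"
      "range \<xi> = {0<..<1}" "(\<xi> \<longlongrightarrow> 1) at_bot" "(\<xi> \<longlongrightarrow> 0) at_top"
    using cubic_flow_exists[of "- a" 0] assms by auto
  let ?\<phi> = "\<lambda>t. vector [\<xi> (- t), 0] :: real ^ 2"
  have "solution_on UNIV (vfield a b c) ?\<phi>"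
    unfolding solution_on_def
  proof
    fix t
    have "((\<lambda>t. \<xi> (- t)) has_real_derivative a * \<xi> (- t) * (1 - \<xi> (- t))) (at t)"
      using DERIV_chain2[OF \<xi>(1)[of "- t"] DERIV_minus[OF DERIV_ident]] by (simp add: algebra_simps)
    from has_vector_derivative_vector2[OF this DERIV_const[of 0]]
    show "(?\<phi> has_vector_derivative vfield a b c (?\<phi> t)) (at t)"
      by (simp add: vfield_def Let_def algebra_simps power2_eq_square)
  qed
  moreover have "range ?\<phi> = segment"
  proof -
    have "range ?\<phi> = (\<lambda>x. vector [x, 0]) ` \<xi> ` range uminus" by (simp only: image_image)
    also have "range uminus = (UNIV :: real set)" by (metis surj_def minus_minus)
    finally show ?thesis using \<xi>(2) by (auto simp: segment_def)
  qed
  moreover have "(?\<phi> \<longlongrightarrow> L) at_bot"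
    unfolding L_def
    by (intro tendsto_vector2 tendsto_const filterlim_compose[OF \<xi>(4) filterlim_uminus_at_top_at_bot])
  moreover have "(?\<phi> \<longlongrightarrow> M) at_top"
    unfolding M_def
    by (intro tendsto_vector2 tendsto_const filterlim_compose[OF \<xi>(3) filterlim_uminus_at_bot_at_top])
  ultimately show ?thesis unfolding connecting_orbit_def by blast
qed

text \<open>Substituting y = x(1 - x) turns the first equation into x' = x (1 - x) (a + b + c x),
  whose last factor is negative at 0 and at 1 by the assumptions.\<close>

lemma connecting_orbit_parabola_arc:
  assumes "a + b < 0" and "a + b + c < 0"
  shows "connecting_orbit (vfield a b c) M L parabola_arc"
proof -
  obtain \<xi> where \<xi>: "\<And>t. (\<xi> has_real_derivative \<xi> t * (1 - \<xi> t) * (a + b + c * \<xi> t)) (at t)"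
      "range \<xi> = {0<..<1}" "(\<xi> \<longlongrightarrow> 1) at_bot" "(\<xi> \<longlongrightarrow> 0) at_top"
    using cubic_flow_exists[of "a + b" c] assms by auto
  let ?\<phi> = "\<lambda>t. vector [\<xi> t, \<xi> t * (1 - \<xi> t)] :: real ^ 2"
  have "solution_on UNIV (vfield a b c) ?\<phi>"
    unfolding solution_on_def
  proof
    fix t
    let ?v = "\<xi> t * (1 - \<xi> t) * (a + b + c * \<xi> t)"
    have "((\<lambda>t. \<xi> t * (1 - \<xi> t)) has_real_derivative ?v * (1 - 2 * \<xi> t)) (at t)"
      by (auto intro!: derivative_eq_intros \<xi>(1) simp: algebra_simps)
    from has_vector_derivative_vector2[OF \<xi>(1) this]
    show "(?\<phi> has_vector_derivative vfield a b c (?\<phi> t)) (at t)"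
      by (simp add: vfield_def Let_def algebra_simps power2_eq_square)
  qed
  moreover have "range ?\<phi> = parabola_arc"
  proof -
    have "range ?\<phi> = (\<lambda>x. vector [x, x * (1 - x)]) ` {0<..<1}"
      unfolding \<xi>(2)[symmetric] by (simp add: image_image)
    then show ?thesis by (auto simp: parabola_arc_def)
  qed
  moreover have "(?\<phi> \<longlongrightarrow> L) at_top"
    using tendsto_vector2[OF \<xi>(4) tendsto_mult[OF \<xi>(4) tendsto_diff[OF tendsto_const[of 1] \<xi>(4)]]]
    by (simp add: L_def)
  moreover have "(?\<phi> \<longlongrightarrow> M) at_bot"
    using tendsto_vector2[OF \<xi>(3) tendsto_mult[OF \<xi>(3) tendsto_diff[OF tendsto_const[of 1] \<xi>(3)]]]
    by (simp add: M_def)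
  ultimately show ?thesis unfolding connecting_orbit_def by blast
qed

section \<open>Monodromy\<close>

lemma eventually_pos_on_ball:
  fixes k :: "real ^ 2 \<Rightarrow> real"
  assumes "isCont k p" and "0 < k p"
  shows "\<forall>\<^sub>F r in at_right 0. \<forall>q\<in>ball p r. 0 < k q"
proof -
  have "\<forall>\<^sub>F q in nhds p. 0 < k q"
    using assms order_tendstoD(1) by (metis isCont_def tendsto_at_iff_tendsto_nhds)
  then obtain d where "d > 0" "\<And>q. dist q p < d \<Longrightarrow> 0 < k q"
    unfolding eventually_nhds_metric by blast
  then show ?thesis
    unfolding eventually_at_right_field
    by (intro exI[of _ d]) (auto simp: dist_commute)
qed

text \<open>On a graph the first coordinate determines the point, so the projection of
  \<open>B\<close> omits \<open>p $ 1\<close>. Being connected, the projection is an interval and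
  stays on one side.\<close>

lemma component_of_punctured_graph_one_sided:
  fixes S :: "(real ^ 2) set"
  assumes B: "B \<in> components (S - {p})" and S: "\<And>q. q \<in> insert p S \<Longrightarrow> q $ 2 = f (q $ 1)"
  shows "(\<forall>q\<in>B. q $ 1 < p $ 1) \<or> (\<forall>q\<in>B. p $ 1 < q $ 1)"
proof -
  have ne: "q $ 1 \<noteq> p $ 1" if "q \<in> B" for q
  proof
    assume "q $ 1 = p $ 1"
    moreover have "q \<in> S - {p}" using in_components_subset[OF B] that by blast
    ultimately show False using S[of q] S[of p] by (auto simp: vec_eq_iff forall_2)
  qed
  have conn: "connected ((\<lambda>q. q $ 1) ` B)"
    by (intro connected_continuous_image continuous_intros in_components_connected[OF B])
  show ?thesis
  proof (rule ccontr)
    assume "\<not> ?thesis"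
    then obtain q q' where q: "q \<in> B" "p $ 1 \<le> q $ 1" "q' \<in> B" "q' $ 1 \<le> p $ 1"
      by (auto simp: not_less)
    have "p $ 1 \<in> (\<lambda>q. q $ 1) ` B"
      by (rule subsetD[OF connected_contains_Icc[OF conn, of "q' $ 1" "q $ 1"]])
        (use q in auto)
    then show False using ne by (metis imageE)
  qed
qed

text \<open>The contour lies in the unit box, the complement of a convex set is its outside, and
  \<open>outside\<close> is antitone.\<close>

lemma outside_contour:
  assumes "q $ 1 < 0 \<or> 1 < q $ 1"
  shows "q \<in> outside ({L, M} \<union> segment \<union> parabola_arc)"
proof -
  have "{L, M} \<union> segment \<union> parabola_arc \<subseteq> cbox 0 1"
    by (auto simp: L_def M_def segment_def parabola_arc_def mem_box_cart forall_2
        intro!: mult_le_one)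
  then have "- cbox 0 1 \<subseteq> outside ({L, M} \<union> segment \<union> parabola_arc)"
    using outside_mono outside_convex[OF convex_box(1)] by metis
  moreover have "q \<notin> cbox 0 1" using assms by (auto simp: mem_box_cart forall_2)
  ultimately show ?thesis by blast
qed

text \<open>A branch lies on one side of the saddle. On the side facing the other saddle,
  \<open>r < 1\<close> keeps it over (0, 1), hence in the segment or the arc; a branch not in the
  contour is therefore on the far side.\<close>

lemma branch_outside_contour:
  assumes B: "B \<in> components (S - {p})" and p: "p \<in> {L, M}"
    and S: "S \<subseteq> ball p r" and r: "r < 1"
    and f: "f = (\<lambda>x. 0) \<or> f = (\<lambda>x. x * (1 - x))"
    and graph: "S \<subseteq> {q. q $ 2 = f (q $ 1)}"
    and nC: "\<not> B \<subseteq> {L, M} \<union> segment \<union> parabola_arc"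
  shows "B \<subseteq> outside ({L, M} \<union> segment \<union> parabola_arc)"
proof -
  have fp: "p $ 2 = f (p $ 1)" using p f by (auto simp: L_def M_def)
  have BS: "q \<in> S" if "q \<in> B" for q using in_components_subset[OF B] that by blast
  have near: "\<bar>q $ 1 - p $ 1\<bar> < 1" if "q \<in> B" for q
  proof -
    have "\<bar>(q - p) $ 1\<bar> \<le> norm (q - p)" by (rule component_le_norm_cart)
    moreover have "norm (q - p) < r" using BS[OF that] S by (auto simp: dist_norm norm_minus_commute)
    ultimately show ?thesis using r by simp
  qed
  have inside: "q \<in> segment \<union> parabola_arc" if "q \<in> B" "0 < q $ 1" "q $ 1 < 1" for q
  proof -
    have "q = vector [q $ 1, f (q $ 1)]"
      using graph BS[OF that(1)] by (auto simp: vec_eq_iff forall_2)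
    then show ?thesis using f that unfolding segment_def parabola_arc_def by blast
  qed
  have out: "q $ 1 < 0 \<or> 1 < q $ 1" if q: "q \<in> B" for q
  proof (cases "p = L")
    case True
    then have p1: "p $ 1 = 0" by (simp add: L_def)
    have "\<not> (\<forall>q\<in>B. p $ 1 < q $ 1)" using nC inside near p1 by fastforce
    then have "\<forall>q\<in>B. q $ 1 < p $ 1"
      using component_of_punctured_graph_one_sided[OF B, of f] graph fp by auto
    then show ?thesis using q p1 by auto
  next
    case False
    then have p1: "p $ 1 = 1" using p by (simp add: M_def)
    have "\<not> (\<forall>q\<in>B. q $ 1 < p $ 1)" using nC inside near p1 by fastforce
    then have "\<forall>q\<in>B. p $ 1 < q $ 1"
      using component_of_punctured_graph_one_sided[OF B, of f] graph fp by auto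
    then show ?thesis using q p1 by auto
  qed
  then show ?thesis using outside_contour by blast
qed

lemma local_stable_manifold_subset: "local_stable_manifold F p U \<subseteq> U"
  by (auto simp: local_stable_manifold_def)

lemma local_unstable_manifold_subset: "local_unstable_manifold F p U \<subseteq> U"
  by (auto simp: local_unstable_manifold_def)

text \<open>Separate \<open>f\<close> and \<open>g\<close> are allowed because at each saddle one
  manifold follows the axis and the other the parabola.\<close>

lemma branches_outside_contour:
  assumes p: "p \<in> {L, M}" and r: "r < 1"
    and f: "f = (\<lambda>x. 0) \<or> f = (\<lambda>x. x * (1 - x))"
    and g: "g = (\<lambda>x. 0) \<or> g = (\<lambda>x. x * (1 - x))"
    and s: "local_stable_manifold F p (ball p r) \<subseteq> {q. q $ 2 = f (q $ 1)}"
    and u: "local_unstable_manifold F p (ball p r) \<subseteq> {q. q $ 2 = g (q $ 1)}"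
  shows "\<forall>B\<in>local_branches F p (ball p r).
    \<not> B \<subseteq> {L, M} \<union> segment \<union> parabola_arc \<longrightarrow>
    B \<subseteq> outside ({L, M} \<union> segment \<union> parabola_arc)"
  using branch_outside_contour[OF _ p local_stable_manifold_subset r f s]
    branch_outside_contour[OF _ p local_unstable_manifold_subset r g u]
  unfolding local_branches_def by blast

lemma monodromic_contour_vfield:
  assumes a: "a > 0" and ab: "a + b < 0" and abc: "a + b + c < 0"
  shows "monodromic_heteroclinic_contour (vfield a b c) L M segment parabola_arc"
proof -
  let ?F = "vfield a b c"
  \<comment> \<open>\<open>?k\<close> is the cofactor of the axis and \<open>?l\<close> that of the
    parabola.\<close>
  let ?k = "\<lambda>q :: real ^ 2. a + b - (2 * a + 2 * b + c) * q $ 1 + 2 * c * q $ 2"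
  let ?l = "\<lambda>q :: real ^ 2. a * (1 - 2 * q $ 1) + 2 * c * q $ 2"
  let ?C = "{L, M} \<union> segment \<union> parabola_arc"
  have "L \<noteq> M" by (metis L_def M_def vector_2(1) zero_neq_one)
  then have "heteroclinic_contour ?F L M segment parabola_arc"
    using assms hyperbolic_saddle_L hyperbolic_saddle_M connecting_orbit_segment
      connecting_orbit_parabola_arc by (simp add: heteroclinic_contour_def)
  moreover have r1: "\<forall>\<^sub>F r :: real in at_right 0. r < 1"
    using eventually_at_right_field by (metis zero_less_one)
  have "\<forall>\<^sub>F r in at_right 0. \<forall>B\<in>local_branches ?F L (ball L r). \<not> B \<subseteq> ?C \<longrightarrow> B \<subseteq> outside ?C"
  proof -
    \<comment> \<open>At \<open>L\<close> the cofactors are \<open>a + b < 0\<close> and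
      \<open>a > 0\<close>: the stable manifold is confined to the parabola, the unstable one to the
      axis.\<close>
    have "\<forall>\<^sub>F r in at_right 0. \<forall>q\<in>ball L r. 0 < - ?k q"
      by (rule eventually_pos_on_ball) (use ab in \<open>auto simp: L_def intro!: continuous_intros\<close>)
    moreover have "\<forall>\<^sub>F r in at_right 0. \<forall>q\<in>ball L r. 0 < ?l q"
      by (rule eventually_pos_on_ball) (use a in \<open>auto simp: L_def intro!: continuous_intros\<close>)
    ultimately show ?thesis using r1
    proof eventually_elim
      case (elim r)
      show ?case
      proof (rule branches_outside_contour[where f = "\<lambda>x. x * (1 - x)" and g = "\<lambda>x. 0"])
        show "local_stable_manifold ?F L (ball L r) \<subseteq> {q. q $ 2 = q $ 1 * (1 - q $ 1)}"
          using local_stable_manifold_subset_darboux[OF darboux_parabola, of L "ball L r" a c b] elim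
          by (auto simp: L_def less_imp_le)
        show "local_unstable_manifold ?F L (ball L r) \<subseteq> {q. q $ 2 = 0}"
        proof (rule local_unstable_manifold_subset_darboux[OF darboux_axis])
          show "?k q \<le> 0" if "q \<in> ball L r" for q using elim that by fastforce
        qed (simp add: L_def)
      qed (use elim in auto)
    qed
  qed
  moreover have "\<forall>\<^sub>F r in at_right 0. \<forall>B\<in>local_branches ?F M (ball M r). \<not> B \<subseteq> ?C \<longrightarrow> B \<subseteq> outside ?C"
  proof -
    \<comment> \<open>At \<open>M\<close> both signs flip, to \<open>- a - b - c > 0\<close> and
      \<open>- a < 0\<close>, so the two curves exchange roles.\<close>
    have "\<forall>\<^sub>F r in at_right 0. \<forall>q\<in>ball M r. 0 < ?k q"
      by (rule eventually_pos_on_ball) (use abc in \<open>auto simp: M_def intro!: continuous_intros\<close>)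
    moreover have "\<forall>\<^sub>F r in at_right 0. \<forall>q\<in>ball M r. 0 < - ?l q"
      by (rule eventually_pos_on_ball) (use a in \<open>auto simp: M_def intro!: continuous_intros\<close>)
    ultimately show ?thesis using r1
    proof eventually_elim
      case (elim r)
      show ?case
      proof (rule branches_outside_contour[where f = "\<lambda>x. 0" and g = "\<lambda>x. x * (1 - x)"])
        show "local_stable_manifold ?F M (ball M r) \<subseteq> {q. q $ 2 = 0}"
          using local_stable_manifold_subset_darboux[OF darboux_axis, of M "ball M r" a b c] elim
          by (auto simp: M_def less_imp_le)
        show "local_unstable_manifold ?F M (ball M r) \<subseteq> {q. q $ 2 = q $ 1 * (1 - q $ 1)}"
        proof -
          have "?l q \<le> 0" if "q \<in> ball M r" for q using elim that by fastforce
          then have "local_unstable_manifold ?F M (ball M r) \<subseteq> {q. q $ 2 - q $ 1 * (1 - q $ 1) = 0}"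
            by (intro local_unstable_manifold_subset_darboux[OF darboux_parabola]) (simp add: M_def)
          then show ?thesis by simp
        qed
      qed (use elim in auto)
    qed
  qed
  ultimately show ?thesis
    by (simp add: monodromic_heteroclinic_contour_def Let_def)
qed

section \<open>The two parameter choices\<close>

theorem mainTheorem1:
  shows
  "Gamma_curve = {p. p $ 2 = 0} \<union> {p. p $ 2 = p $ 1 * (1 - p $ 1)} \<and>
   (\<forall>a b c :: real.
      (\<forall>p\<in>Gamma_curve. \<exists>D. GDERIV G p :> D \<and> D \<bullet> vfield a b c p = 0) \<and>
      vfield a b c L = 0 \<and> vfield a b c M = 0 \<and>
      eigenvalues (jacobian (vfield a b c) (at L)) =
        {#complex_of_real a, complex_of_real (a + b)#} \<and>
      eigenvalues (jacobian (vfield a b c) (at M)) =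
        {#complex_of_real (- a), complex_of_real (- a - b - c)#}) \<and>
   (let F = vfield 1 (- 3) (3 / 2) in
      hyperbolic_saddle F L \<and> hyperbolic_saddle F M \<and>
      saddle_index F L = 2 \<and> saddle_index F M = 2 \<and>
      monodromic_heteroclinic_contour F L M segment parabola_arc) \<and>
   (let F = vfield 1 (- 3) (1 / 2) in
      hyperbolic_saddle F L \<and> hyperbolic_saddle F M \<and>
      saddle_index F L = 2 \<and> saddle_index F M = 2 / 3 \<and>
      saddle_index F L * saddle_index F M = 4 / 3 \<and>
      saddle_index F L * saddle_index F M > 1 \<and>
      monodromic_heteroclinic_contour F L M segment parabola_arc)"
proof -
  have L: "saddle_index (vfield 1 (- 3) c) L = 2" for c
    using saddle_index_eq[OF saddle_eigenvalues_L[of 1 "- 3" c]] by simp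
  \<comment> \<open>\<open>c < 2\<close> is the condition \<open>a + b + c < 0\<close> here;
    \<open>c = 3/2\<close> gives index 2 and \<open>c = 1/2\<close> gives 2/3.\<close>
  have M: "saddle_index (vfield 1 (- 3) c) M = 1 / (2 - c)" if "c < 2" for c
    using saddle_index_eq[OF saddle_eigenvalues_M[of 1 "- 3" c]] that by simp
  show ?thesis
    unfolding Let_def
    using Gamma_curve_eq Gamma_curve_invariant eigenvalues_vfield_L eigenvalues_vfield_M
    by (simp add: L M hyperbolic_saddle_L hyperbolic_saddle_M monodromic_contour_vfield)
qed

end
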